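(* Let $d,n,N\ge1$ be integers, $\epsilon,\delta>0$, and let $\nu(\mathbf{\Sigma})$ denote any one of $\|\mathbf{\Sigma}\|_F$, $\mathrm{Tr}(\mathbf{\Sigma})$, $\|\mathbf{\Sigma}\|_{op}$. Consider the optimization $$\inf_{\mathbf{A},\mathbf{B}\in\mathbb{R}^{d\times d}}\ \sup_{\substack{(\mathbb{P},\mathbb{Q}):\ \mathcal{W}_2(\mathbb{P},\mathbb{Q})\le\epsilon,\\ \nu(\mathbf{\Sigma}_{\mathbf{X}})\ge\delta^2}} \frac{\mathbb{E}\left\|\mathbf{A}\frac{1}{n}\sum_{i=1}^n\mathbf{X}_i+\mathbf{B}\frac{1}{N}\sum_{j=1}^N\mathbf{Z}_j-\boldsymbol{\mu}_{\mathbf{X}}\right\|^2}{\nu(\mathbf{\Sigma}_{\mathbf{X}})}.$$ Without loss of generality one may take $\mathbb{P}=\mathcal{N}(\boldsymbol{\mu}_{\mathbf{X}},\mathbf{\Sigma}_{\mathbf{X}})$ and $\mathbb{Q}=\mathcal{N}(\boldsymbol{\mu}_{\mathbf{Z}},\mathbf{\Sigma}_{\mathbf{Z}})$; that is, for every $\mathbf{A},\mathbf{B}$ the inner supremum (and hence the value of the whole optimization) is unchanged if it is restricted to feasible pairs $(\mathbb{P},\mathbb{Q})$ in which both $\mathbb{P}$ and $\mathbb{Q}$ are (possibly degenerate) Gaussian distributions on $\mathbb{R}^d$.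
   Context: The supremum ranges over pairs $(\mathbb{P},\mathbb{Q})$ of Borel probability measures on $\mathbb{R}^d$ with finite second moments. $\mathbf{X}_1,\dots,\mathbf{X}_n$ are i.i.d. samples from $\mathbb{P}$ and $\mathbf{Z}_1,\dots,\mathbf{Z}_N$ are i.i.d. samples from $\mathbb{Q}$, the two collections being independent of each other; the expectation is over all these samples. $\boldsymbol{\mu}_{\mathbf{X}},\mathbf{\Sigma}_{\mathbf{X}}$ are the mean and covariance matrix of $\mathbb{P}$, and $\boldsymbol{\mu}_{\mathbf{Z}},\mathbf{\Sigma}_{\mathbf{Z}}$ those of $\mathbb{Q}$. $\|\cdot\|$ is the Euclidean norm, $\|\cdot\|_F$ the Frobenius norm, $\|\cdot\|_{op}$ the operator (spectral) norm. The Wasserstein-2 distance is $\mathcal{W}_2(\mathbb{P},\mathbb{Q})=\inf_{\gamma}\left(\int\|x_1-x_2\|^2\,\gamma(dx_1,dx_2)\right)^{1/2}$, the infimum being over all couplings $\gamma$ of $\mathbb{P}$ and $\mathbb{Q}$. *)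

theory Defs
  imports "HOL-Probability.Probability"
begin

definition mean_vec :: "(real ^ 'd) measure \<Rightarrow> real ^ 'd" where
  "mean_vec P = (\<integral>x. x \<partial>P)"

definition cov_mat :: "(real ^ 'd) measure \<Rightarrow> real ^ 'd ^ 'd" where
  "cov_mat P = (\<chi> i j. \<integral>x. (x $ i - mean_vec P $ i) * (x $ j - mean_vec P $ j) \<partial>P)"

definition frobenius_norm :: "real ^ 'd ^ 'd \<Rightarrow> real" where
  "frobenius_norm S = sqrt (\<Sum>i\<in>UNIV. \<Sum>j\<in>UNIV. (S $ i $ j)\<^sup>2)"

definition operator_norm :: "real ^ 'd ^ 'd \<Rightarrow> real" where
  "operator_norm S = onorm (\<lambda>x. S *v x)"

definition prob2 :: "(real ^ 'd) measure set" where
  "prob2 = {P. prob_space P \<and> sets P = sets borel \<and> integrable P (\<lambda>x. (norm x)\<^sup>2)}"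

definition couplings ::
  "(real ^ 'd) measure \<Rightarrow> (real ^ 'd) measure \<Rightarrow> ((real ^ 'd) \<times> (real ^ 'd)) measure set" where
  "couplings P Q = {\<gamma>. prob_space \<gamma> \<and> sets \<gamma> = sets (borel \<Otimes>\<^sub>M borel) \<and>
                       distr \<gamma> borel fst = P \<and> distr \<gamma> borel snd = Q}"

text \<open>Intended for arguments in \<open>prob2\<close> only: there \<open>P \<Otimes>\<^sub>M Q\<close> is a coupling and the
  quadratic cost is integrable under every coupling, so neither the real infimum nor the
  Bochner integral takes a default value.\<close>

definition wasserstein2 :: "(real ^ 'd) measure \<Rightarrow> (real ^ 'd) measure \<Rightarrow> real" where
  "wasserstein2 P Q = (INF \<gamma>\<in>couplings P Q. sqrt (\<integral>(x, y). (norm (x - y))\<^sup>2 \<partial>\<gamma>))"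

text \<open>The univariate normal law with variance \<open>v \<ge> 0\<close>, the case \<open>v = 0\<close> being a point mass.
  A law on Euclidean space is normal iff all its one-dimensional projections are; this
  covers singular covariance matrices, for which there is no Lebesgue density.\<close>

definition normal_law1 :: "real \<Rightarrow> real \<Rightarrow> real measure" where
  "normal_law1 m v =
     (if v = 0 then return borel m else density lborel (normal_density m (sqrt v)))"

definition is_normal_law :: "real ^ 'd \<Rightarrow> real ^ 'd ^ 'd \<Rightarrow> (real ^ 'd) measure \<Rightarrow> bool" where
  "is_normal_law m S P \<longleftrightarrow>
     prob_space P \<and> sets P = sets borel \<and>
     transpose S = S \<and> (\<forall>t. 0 \<le> t \<bullet> (S *v t)) \<and>
     (\<forall>t. distr P borel (\<lambda>x. t \<bullet> x) = normal_law1 (t \<bullet> m) (t \<bullet> (S *v t)))"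

definition feasible ::
  "(real ^ 'd ^ 'd \<Rightarrow> real) \<Rightarrow> real \<Rightarrow> real \<Rightarrow> ((real ^ 'd) measure \<times> (real ^ 'd) measure) set" where
  "feasible \<nu> \<epsilon> \<delta> =
     {(P, Q). P \<in> prob2 \<and> Q \<in> prob2 \<and> wasserstein2 P Q \<le> \<epsilon> \<and> \<nu> (cov_mat P) \<ge> \<delta>\<^sup>2}"

definition gaussian_pairs :: "((real ^ 'd) measure \<times> (real ^ 'd) measure) set" where
  "gaussian_pairs =
     {(P, Q). is_normal_law (mean_vec P) (cov_mat P) P \<and> is_normal_law (mean_vec Q) (cov_mat Q) Q}"

text \<open>The joint law of the two independent i.i.d. samples is the product measure below.\<close>

definition mean_sq_error ::
  "nat \<Rightarrow> nat \<Rightarrow> real ^ 'd ^ 'd \<Rightarrow> real ^ 'd ^ 'd \<Rightarrow>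
     (real ^ 'd) measure \<Rightarrow> (real ^ 'd) measure \<Rightarrow> ennreal" where
  "mean_sq_error n N A B P Q =
     (\<integral>\<^sup>+(x, z). ennreal ((norm (A *v ((1 / real n) *\<^sub>R (\<Sum>i<n. x i))
                              + B *v ((1 / real N) *\<^sub>R (\<Sum>j<N. z j)) - mean_vec P))\<^sup>2)
        \<partial>((\<Pi>\<^sub>M i\<in>{..<n}. P) \<Otimes>\<^sub>M (\<Pi>\<^sub>M j\<in>{..<N}. Q)))"

text \<open>Values lie in \<open>[0, \<infinity>]\<close> because the supremum over pairs is infinite unless
  \<open>A + B\<close> is the identity matrix.\<close>

definition normalized_risk ::
  "(real ^ 'd ^ 'd \<Rightarrow> real) \<Rightarrow> nat \<Rightarrow> nat \<Rightarrow> real ^ 'd ^ 'd \<Rightarrow> real ^ 'd ^ 'd \<Rightarrow>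
     (real ^ 'd) measure \<times> (real ^ 'd) measure \<Rightarrow> ennreal" where
  "normalized_risk \<nu> n N A B = (\<lambda>(P, Q). mean_sq_error n N A B P Q / ennreal (\<nu> (cov_mat P)))"

end

theory Submission
  imports Defs
begin

text \<open>The risk is the sum of a squared bias and of variances of two independent sample means, so
  it depends on \<open>P\<close> and \<open>Q\<close> only through their means and covariances. It therefore
  suffices to replace a feasible pair by a Gaussian pair with the same moments whose Wasserstein
  distance is not larger. The cost of a coupling is likewise determined by the moments and the
  cross-covariance \<open>C\<close> of the coupling, and the joint covariance, with blocks
  \<open>cov_mat P\<close>, \<open>C\<close> and \<open>cov_mat Q\<close>, is positive semidefinite.
  Positivity bounds the entries of \<open>C\<close>, so along a minimising sequence of couplings a
  subsequence of the cross-covariances converges to some \<open>C'\<close> that is still admissible. A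
  jointly Gaussian vector whose cross-covariance is \<open>C'\<close> is then a coupling of two Gaussian
  laws with the prescribed moments and cost at most \<open>(wasserstein2 P Q)\<^sup>2\<close>. Passing to the
  limit in \<open>C\<close> rather than in the couplings avoids Prokhorov's theorem and the uniqueness of
  the Gaussian law with given moments.\<close>

subsection \<open>Second moments\<close>

lemma integrable_mult_squares:
  fixes f g :: "'a \<Rightarrow> real"
  assumes [measurable]: "f \<in> borel_measurable M" "g \<in> borel_measurable M"
    and "integrable M (\<lambda>x. (f x)\<^sup>2)" "integrable M (\<lambda>x. (g x)\<^sup>2)"
  shows "integrable M (\<lambda>x. f x * g x)"
proof (rule Bochner_Integration.integrable_bound)
  show "integrable M (\<lambda>x. (f x)\<^sup>2 + (g x)\<^sup>2)" using assms by simp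
  have "\<bar>a * b\<bar> \<le> a\<^sup>2 + b\<^sup>2" for a b :: real
    using sum_squares_bound[of "\<bar>a\<bar>" "\<bar>b\<bar>"] abs_ge_zero[of "a * b"]
    unfolding abs_mult power2_abs mult.assoc by linarith
  then show "AE x in M. norm (f x * g x) \<le> norm ((f x)\<^sup>2 + (g x)\<^sup>2)" by simp
qed simp

text \<open>Measurability is included because integrability of the squared norm does not imply it
  for \<open>f\<close> itself.\<close>

definition sq_integrable :: "'a measure \<Rightarrow> ('a \<Rightarrow> 'b::euclidean_space) \<Rightarrow> bool" where
  "sq_integrable M f \<longleftrightarrow> f \<in> borel_measurable M \<and> integrable M (\<lambda>x. (norm (f x))\<^sup>2)"

lemma sq_integrable_inner:
  assumes "sq_integrable M f" "sq_integrable M g"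
  shows "integrable M (\<lambda>x. f x \<bullet> g x)"
proof (rule Bochner_Integration.integrable_bound)
  have [measurable]: "f \<in> borel_measurable M" "g \<in> borel_measurable M"
    using assms by (auto simp: sq_integrable_def)
  show "integrable M (\<lambda>x. norm (f x) * norm (g x))"
    using assms by (intro integrable_mult_squares) (auto simp: sq_integrable_def)
  show "AE x in M. norm (f x \<bullet> g x) \<le> norm (norm (f x) * norm (g x))"
    by (simp add: Cauchy_Schwarz_ineq2)
  show "(\<lambda>x. f x \<bullet> g x) \<in> borel_measurable M" by measurable
qed

lemma sq_integrable_add:
  assumes "sq_integrable M f" "sq_integrable M g"
  shows "sq_integrable M (\<lambda>x. f x + g x)"
proof -
  have "(norm (f x + g x))\<^sup>2 = (norm (f x))\<^sup>2 + 2 * (f x \<bullet> g x) + (norm (g x))\<^sup>2" for x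
    unfolding power2_norm_eq_inner by (simp add: inner_add_left inner_add_right inner_commute)
  then show ?thesis using assms sq_integrable_inner[OF assms] by (auto simp: sq_integrable_def)
qed

lemma sq_integrable_bounded_linear:
  assumes "sq_integrable M f" "bounded_linear h"
  shows "sq_integrable M (\<lambda>x. h (f x))"
proof -
  interpret h: bounded_linear h by fact
  have [measurable]: "f \<in> borel_measurable M" and i: "integrable M (\<lambda>x. (norm (f x))\<^sup>2)"
    using assms by (auto simp: sq_integrable_def)
  have [measurable]: "h \<in> borel_measurable borel"
    by (intro borel_measurable_continuous_onI h.continuous_on continuous_on_id)
  obtain K where K: "\<And>x. norm (h x) \<le> norm x * K" using h.bounded by blast
  have "integrable M (\<lambda>x. (norm (h (f x)))\<^sup>2)"
  proof (rule Bochner_Integration.integrable_bound)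
    show "integrable M (\<lambda>x. K\<^sup>2 * (norm (f x))\<^sup>2)" using i by simp
    have "(norm (h x))\<^sup>2 \<le> K\<^sup>2 * (norm x)\<^sup>2" for x
      using power_mono[OF K[of x], of 2] by (simp add: power_mult_distrib mult.commute)
    then show "AE x in M. norm ((norm (h (f x)))\<^sup>2) \<le> norm (K\<^sup>2 * (norm (f x))\<^sup>2)" by simp
  qed measurable
  then show ?thesis by (simp add: sq_integrable_def)
qed

lemma sq_integrable_const: "finite_measure M \<Longrightarrow> sq_integrable M (\<lambda>x. c)"
  by (simp add: sq_integrable_def finite_measure.integrable_const)

lemma sq_integrable_imp_integrable:
  assumes "finite_measure M" "sq_integrable M f"
  shows "integrable M f"
proof (rule Bochner_Integration.integrable_bound)
  interpret finite_measure M by fact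
  show "integrable M (\<lambda>x. 1 + (norm (f x))\<^sup>2)" using assms by (simp add: sq_integrable_def)
  have "a \<le> 1 + a\<^sup>2" for a :: real using sum_squares_bound[of a 1] zero_le_power2[of a]
    unfolding mult_1_right power_one by linarith
  then show "AE x in M. norm (f x) \<le> norm (1 + (norm (f x))\<^sup>2)" by simp
qed (use assms in \<open>simp add: sq_integrable_def\<close>)

lemma sq_integrable_distr:
  assumes "T \<in> M \<rightarrow>\<^sub>M N" "sq_integrable (distr M N T) f"
  shows "sq_integrable M (\<lambda>x. f (T x))"
  using assms by (auto simp: sq_integrable_def integrable_distr_eq intro: measurable_compose)

text \<open>Nothing is centred here: callers pass functions from which the means have already been
  subtracted.\<close>

definition cross_cov :: "'a measure \<Rightarrow> ('a \<Rightarrow> real ^ 'd) \<Rightarrow> ('a \<Rightarrow> real ^ 'd) \<Rightarrow> real ^ 'd ^ 'd" where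
  "cross_cov M f g = (\<chi> i j. \<integral>x. f x $ i * g x $ j \<partial>M)"

text \<open>Expansion in coordinates leaves finite sums of the integrable products
  \<open>f x $ i * g x $ j\<close>. Risks and transport costs thereby become quadratic forms and
  traces of matrices.\<close>

lemma
  fixes f g :: "'a \<Rightarrow> real ^ 'd"
  assumes f: "sq_integrable M f" and g: "sq_integrable M g"
  shows integrable_inner_mult: "integrable M (\<lambda>x. (s \<bullet> f x) * (t \<bullet> g x))"
    and integral_inner_mult: "(\<integral>x. (s \<bullet> f x) * (t \<bullet> g x) \<partial>M) = s \<bullet> (cross_cov M f g *v t)"
    and integrable_inner_cross: "integrable M (\<lambda>x. f x \<bullet> g x)"
    and integral_inner_cross: "(\<integral>x. f x \<bullet> g x \<partial>M) = trace (cross_cov M f g)"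
proof -
  have i: "integrable M (\<lambda>x. f x $ i * g x $ j)" for i j
    using sq_integrable_inner[OF sq_integrable_bounded_linear[OF f bounded_linear_vec_nth]
      sq_integrable_bounded_linear[OF g bounded_linear_vec_nth]] by simp
  have eq: "(s \<bullet> f x) * (t \<bullet> g x) = (\<Sum>i\<in>UNIV. \<Sum>j\<in>UNIV. s $ i * t $ j * (f x $ i * g x $ j))" for x
    by (simp add: inner_vec_def sum_product mult_ac)
  show "integrable M (\<lambda>x. (s \<bullet> f x) * (t \<bullet> g x))" unfolding eq using i by simp
  show "(\<integral>x. (s \<bullet> f x) * (t \<bullet> g x) \<partial>M) = s \<bullet> (cross_cov M f g *v t)"
    unfolding eq using i
    by (simp add: cross_cov_def inner_vec_def matrix_vector_mult_def sum_distrib_left mult_ac)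
  show "integrable M (\<lambda>x. f x \<bullet> g x)" using i by (simp add: inner_vec_def)
  show "(\<integral>x. f x \<bullet> g x \<partial>M) = trace (cross_cov M f g)"
    using i by (simp add: inner_vec_def cross_cov_def trace_def)
qed

lemma prob2_sq_integrable_centred:
  assumes "P \<in> prob2"
  shows "sq_integrable P (\<lambda>x. x - c)"
proof -
  have [measurable_cong]: "sets P = sets borel" using assms by (simp add: prob2_def)
  interpret prob_space P using assms by (simp add: prob2_def)
  have "sq_integrable P (\<lambda>x. x)" using assms by (simp add: prob2_def sq_integrable_def)
  from sq_integrable_add[OF this sq_integrable_const[of P "- c"]]
  show ?thesis by (simp add: finite_measure_axioms)
qed

lemma prob2_integral_centred:
  assumes "P \<in> prob2"
  shows "(\<integral>x. x - mean_vec P \<partial>P) = 0"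
proof -
  interpret prob_space P using assms by (simp add: prob2_def)
  have "integrable P (\<lambda>x. x)"
    using sq_integrable_imp_integrable[OF finite_measure_axioms prob2_sq_integrable_centred[OF assms, of 0]]
    by simp
  then show ?thesis by (simp add: mean_vec_def prob_space)
qed

lemma cov_mat_eq_cross_cov: "cov_mat P = cross_cov P (\<lambda>x. x - mean_vec P) (\<lambda>x. x - mean_vec P)"
  by (simp add: cov_mat_def cross_cov_def)

subsection \<open>Standard Gaussian vectors and univariate normal laws\<close>

text \<open>Any finite index type is allowed, so that \<open>'d + 'd\<close> can later supply the
  common randomness of two coupled vectors.\<close>

definition std_gauss :: "('a::finite \<Rightarrow> real) measure" where
  "std_gauss = (\<Pi>\<^sub>M k\<in>UNIV. density lborel std_normal_density)"

lemma prob_space_std_normal: "prob_space (density lborel std_normal_density)"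
  by (rule prob_space_normal_density) simp

lemma prob_space_std_gauss: "prob_space std_gauss"
  unfolding std_gauss_def by (intro prob_space_PiM prob_space_std_normal)

lemma measurable_std_gauss_component [measurable]: "(\<lambda>\<omega>. \<omega> k) \<in> borel_measurable std_gauss"
  unfolding std_gauss_def by measurable

text \<open>Independence amounts to equality of the joint law with the product of the marginal laws.
  The joint map is restriction to \<open>I\<close>, which is the identity on the extensional
  functions that make up the product space.\<close>

lemma indep_vars_PiM_components:
  assumes "I \<noteq> {}" and "\<And>i. i \<in> I \<Longrightarrow> prob_space (M i)"
  shows "prob_space.indep_vars (PiM I M) M (\<lambda>i \<omega>. \<omega> i) I"
proof -
  interpret prob_space "PiM I M" using assms(2) by (rule prob_space_PiM)
  have "distr (PiM I M) (PiM I M) (\<lambda>\<omega>. \<lambda>i\<in>I. \<omega> i) = distr (PiM I M) (PiM I M) (\<lambda>\<omega>. \<omega>)"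
    by (intro distr_cong) (auto simp: space_PiM)
  also have "\<dots> = (\<Pi>\<^sub>M i\<in>I. distr (PiM I M) (M i) (\<lambda>\<omega>. \<omega> i))"
    using assms by (simp add: distr_id distr_PiM_component cong: PiM_cong)
  finally show ?thesis
    using assms(1) by (subst indep_vars_iff_distr_eq_PiM') auto
qed

text \<open>A sum of independent normals is normal with added variances. That rule needs positive
  deviations, so zero coefficients are dropped first; if all of them vanish, the law is the point
  mass at \<open>a\<close>.\<close>

lemma distr_std_gauss_affine:
  fixes b :: "'a::finite \<Rightarrow> real"
  shows "distr std_gauss borel (\<lambda>\<omega>. a + (\<Sum>k\<in>UNIV. b k * \<omega> k)) = normal_law1 a (\<Sum>k\<in>UNIV. (b k)\<^sup>2)"
proof (cases "\<forall>k. b k = 0")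
  case True
  interpret prob_space "std_gauss :: ('a \<Rightarrow> real) measure" by (rule prob_space_std_gauss)
  show ?thesis using True by (simp add: normal_law1_def distr_const)
next
  case False
  interpret G: prob_space "std_gauss :: ('a \<Rightarrow> real) measure" by (rule prob_space_std_gauss)
  define K where "K = {k. b k \<noteq> 0}"
  have K: "K \<noteq> {}" using False by (auto simp: K_def)
  have comp: "distributed std_gauss lborel (\<lambda>\<omega>. \<omega> k) std_normal_density" for k :: 'a
  proof -
    have "distr std_gauss (density lborel std_normal_density) (\<lambda>\<omega>. \<omega> k) = density lborel std_normal_density"
      unfolding std_gauss_def by (intro distr_PiM_component prob_space_std_normal) simp
    moreover have "distr std_gauss lborel (\<lambda>\<omega>. \<omega> k) = distr std_gauss (density lborel std_normal_density) (\<lambda>\<omega>. \<omega> k)"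
      by (intro distr_cong) auto
    ultimately show ?thesis by (auto simp: distributed_def)
  qed
  have "distributed std_gauss lborel (\<lambda>\<omega>. 0 + b k * \<omega> k) (normal_density (0 + b k * 0) (\<bar>b k\<bar> * 1))"
    if "k \<in> K" for k
    using that by (intro G.normal_density_affine comp) (auto simp: K_def)
  then have lin: "distributed std_gauss lborel (\<lambda>\<omega>. b k * \<omega> k) (normal_density 0 \<bar>b k\<bar>)" if "k \<in> K" for k
    using that by simp
  have "G.indep_vars (\<lambda>_. density lborel std_normal_density) (\<lambda>k \<omega>. \<omega> k) UNIV"
    unfolding std_gauss_def by (intro indep_vars_PiM_components prob_space_std_normal) simp
  then have "G.indep_vars (\<lambda>_. borel) (\<lambda>k \<omega>. b k * \<omega> k) UNIV"
    by (rule G.indep_vars_compose2) simp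
  then have "G.indep_vars (\<lambda>_. borel) (\<lambda>k \<omega>. b k * \<omega> k) K"
    by (rule G.indep_vars_subset) simp
  from G.sum_indep_normal[OF _ K this _ lin]
  have "distributed std_gauss lborel (\<lambda>\<omega>. \<Sum>k\<in>K. b k * \<omega> k) (normal_density 0 (sqrt (\<Sum>k\<in>K. \<bar>b k\<bar>\<^sup>2)))"
    by (simp add: K_def)
  moreover have "(\<Sum>k\<in>K. b k * \<omega> k) = (\<Sum>k\<in>UNIV. b k * \<omega> k)" for \<omega>
    by (rule sum.mono_neutral_left) (auto simp: K_def)
  moreover have "(\<Sum>k\<in>K. \<bar>b k\<bar>\<^sup>2) = (\<Sum>k\<in>UNIV. (b k)\<^sup>2)"
    unfolding power2_abs by (rule sum.mono_neutral_left) (auto simp: K_def)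
  ultimately have D: "distributed std_gauss lborel (\<lambda>\<omega>. \<Sum>k\<in>UNIV. b k * \<omega> k)
      (normal_density 0 (sqrt (\<Sum>k\<in>UNIV. (b k)\<^sup>2)))" by simp
  have pos: "0 < (\<Sum>k\<in>UNIV. (b k)\<^sup>2)"
    using False by (auto intro!: sum_pos2)
  from G.normal_density_affine[OF D, of 1 a] pos
  have "distributed std_gauss lborel (\<lambda>\<omega>. a + (\<Sum>k\<in>UNIV. b k * \<omega> k))
      (normal_density a (sqrt (\<Sum>k\<in>UNIV. (b k)\<^sup>2)))" by simp
  then have "distr std_gauss lborel (\<lambda>\<omega>. a + (\<Sum>k\<in>UNIV. b k * \<omega> k))
      = density lborel (normal_density a (sqrt (\<Sum>k\<in>UNIV. (b k)\<^sup>2)))"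
    by (rule distributed_distr_eq_density)
  moreover have "distr std_gauss lborel (\<lambda>\<omega>. a + (\<Sum>k\<in>UNIV. b k * \<omega> k))
      = distr std_gauss borel (\<lambda>\<omega>. a + (\<Sum>k\<in>UNIV. b k * \<omega> k))"
    by (intro distr_cong) auto
  ultimately show ?thesis using pos by (simp add: normal_law1_def)
qed

text \<open>The centre \<open>c\<close> is left free: \<open>c = 0\<close> will give square
  integrability of coordinates, and \<open>c = t \<bullet> m\<close> the variance of a
  projection.\<close>

lemma
  assumes "0 \<le> v"
  shows integral_normal_law1: "(\<integral>x. x \<partial>normal_law1 m v) = m"
    and integrable_normal_law1_square: "integrable (normal_law1 m v) (\<lambda>x. (x - c)\<^sup>2)"
    and integral_normal_law1_square: "(\<integral>x. (x - c)\<^sup>2 \<partial>normal_law1 m v) = v + (m - c)\<^sup>2"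
proof -
  have "(\<integral>x. x \<partial>normal_law1 m v) = m
      \<and> integrable (normal_law1 m v) (\<lambda>x. (x - c)\<^sup>2) \<and> (\<integral>x. (x - c)\<^sup>2 \<partial>normal_law1 m v) = v + (m - c)\<^sup>2"
  proof (cases "v = 0")
    case True
    have ps: "prob_space (return borel m)" by (rule prob_space_return) simp
    have i: "integrable (return borel m) f" if "f \<in> borel_measurable borel" for f :: "real \<Rightarrow> real"
      using that by (subst integrable_iff_bounded) (simp add: nn_integral_return)
    show ?thesis using True by (auto simp: normal_law1_def integral_return intro!: i)
  next
    case False
    with assms have v: "0 < sqrt v" by simp
    let ?D = "normal_density m (sqrt v)"
    \<comment> \<open>The square is rewritten through the second central moment, the first moment
      and the total mass, whose values are known.\<close>
    have sq: "?D x * (x - c)\<^sup>2 = ?D x * (x - m)^2 + 2 * (m - c) * (?D x * x) + (c\<^sup>2 - m\<^sup>2) * ?D x" for x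
      by (simp add: power2_eq_square algebra_simps)
    note i = integrable_normal_moment[OF v, of m 2] integrable_normal_moment_nz_1[OF v, of m]
      integrable_normal_density[OF v, of m]
    have "integral\<^sup>L lborel (\<lambda>x. ?D x * (x - m)^2) = v"
      using integral_normal_moment_even[OF v, of m 1] assms False by (simp add: fact_numeral)
    then have "integral\<^sup>L lborel (\<lambda>x. ?D x * (x - c)\<^sup>2) = v + 2 * (m - c) * m + (c\<^sup>2 - m\<^sup>2)"
      unfolding sq using i integral_normal_moment_nz_1[OF v, of m] integral_normal_density[OF v, of m] by simp
    moreover have "integrable lborel (\<lambda>x. ?D x * (x - c)\<^sup>2)"
      unfolding sq using i by auto
    ultimately show ?thesis using False i integral_normal_moment_nz_1[OF v, of m]
      by (simp add: normal_law1_def integrable_density integral_density normal_density_nonneg power2_eq_square algebra_simps)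
  qed
  then show "(\<integral>x. x \<partial>normal_law1 m v) = m"
    "integrable (normal_law1 m v) (\<lambda>x. (x - c)\<^sup>2)" "(\<integral>x. (x - c)\<^sup>2 \<partial>normal_law1 m v) = v + (m - c)\<^sup>2"
    by auto
qed

subsection \<open>The risk in terms of means and covariances\<close>

text \<open>After expanding the square, a mixed term with \<open>i \<noteq> j\<close> factorises by
  independence and vanishes because the means are zero. Only the diagonal survives.\<close>

lemma (in prob_space) second_moment_sum_indep:
  fixes Y :: "'i \<Rightarrow> 'a \<Rightarrow> real"
  assumes "finite I" and indep: "indep_vars (\<lambda>_. borel) Y I"
    and sq: "\<And>i. i \<in> I \<Longrightarrow> integrable M (\<lambda>x. (Y i x)\<^sup>2)"
    and zero: "\<And>i. i \<in> I \<Longrightarrow> expectation (Y i) = 0"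
  shows "integrable M (\<lambda>x. (\<Sum>i\<in>I. Y i x)\<^sup>2)"
    and "expectation (\<lambda>x. (\<Sum>i\<in>I. Y i x)\<^sup>2) = (\<Sum>i\<in>I. expectation (\<lambda>x. (Y i x)\<^sup>2))"
proof -
  have meas: "Y i \<in> borel_measurable M" if "i \<in> I" for i
    using indep that by (auto simp: indep_vars_def)
  have prod: "integrable M (\<lambda>x. Y i x * Y j x)" if "i \<in> I" "j \<in> I" for i j
    using that by (intro integrable_mult_squares meas sq)
  have int: "integrable M (Y i)" if "i \<in> I" for i
    using square_integrable_imp_integrable[OF meas sq] that by simp
  have "expectation (\<lambda>x. Y i x * Y j x) = of_bool (i = j) * expectation (\<lambda>x. (Y i x)\<^sup>2)"
    if "i \<in> I" "j \<in> I" for i j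
  proof (cases "i = j")
    case False
    have "indep_vars (\<lambda>_. borel) Y {i, j}" using indep that by (auto intro: indep_vars_subset)
    from indep_vars_lebesgue_integral[OF _ this] int that False zero[OF that(1)]
    show ?thesis by auto
  qed (simp add: power2_eq_square)
  note E = this
  have eq: "(\<Sum>i\<in>I. Y i x)\<^sup>2 = (\<Sum>i\<in>I. \<Sum>j\<in>I. Y i x * Y j x)" for x
    by (simp add: power2_eq_square sum_product)
  show "integrable M (\<lambda>x. (\<Sum>i\<in>I. Y i x)\<^sup>2)"
    unfolding eq by (intro Bochner_Integration.integrable_sum prod)
  have "expectation (\<lambda>x. (\<Sum>i\<in>I. Y i x)\<^sup>2)
      = (\<Sum>i\<in>I. \<Sum>j\<in>I. of_bool (i = j) * expectation (\<lambda>x. (Y i x)\<^sup>2))"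
    unfolding eq using prod E
    by (subst Bochner_Integration.integral_sum) (auto intro!: sum.cong)
  also have "\<dots> = (\<Sum>i\<in>I. expectation (\<lambda>x. (Y i x)\<^sup>2))"
    using \<open>finite I\<close> by (intro sum.cong refl) (simp add: of_bool_def if_distrib if_distribR cong: if_cong)
  finally show "expectation (\<lambda>x. (\<Sum>i\<in>I. Y i x)\<^sup>2) = (\<Sum>i\<in>I. expectation (\<lambda>x. (Y i x)\<^sup>2))" .
qed

text \<open>The bias-variance split: the mixed term \<open>2 * k * Y x\<close> integrates to zero.
  The nonnegative integral appears because \<open>mean_sq_error\<close> takes values in
  \<open>ennreal\<close>.\<close>

lemma (in prob_space) nn_integral_centred_square:
  fixes Y :: "'a \<Rightarrow> real"
  assumes Y: "Y \<in> borel_measurable M" "integrable M (\<lambda>x. (Y x)\<^sup>2)" and zero: "expectation Y = 0"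
  shows "(\<integral>\<^sup>+x. ennreal ((Y x + k)\<^sup>2) \<partial>M) = ennreal (expectation (\<lambda>x. (Y x)\<^sup>2) + k\<^sup>2)"
proof -
  have i: "integrable M Y" by (rule square_integrable_imp_integrable[OF Y])
  have eq: "(Y x + k)\<^sup>2 = (Y x)\<^sup>2 + 2 * k * Y x + k\<^sup>2" for x
    by (simp add: power2_eq_square algebra_simps)
  have "(\<integral>\<^sup>+x. ennreal ((Y x + k)\<^sup>2) \<partial>M) = ennreal (expectation (\<lambda>x. (Y x + k)\<^sup>2))"
  proof (rule nn_integral_eq_integral)
    show "integrable M (\<lambda>x. (Y x + k)\<^sup>2)" unfolding eq using Y i by simp
  qed simp
  also have "expectation (\<lambda>x. (Y x + k)\<^sup>2) = expectation (\<lambda>x. (Y x)\<^sup>2) + k\<^sup>2"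
    unfolding eq using Y i zero by (simp add: prob_space)
  finally show ?thesis .
qed

lemma sample_mean_moments:
  fixes P :: "(real ^ 'd) measure" and a :: "real ^ 'd"
  assumes P: "P \<in> prob2" and n: "n \<ge> (1::nat)"
  defines "M \<equiv> (\<Pi>\<^sub>M i\<in>{..<n}. P)"
    and "Y \<equiv> (\<lambda>x. a \<bullet> ((1 / real n) *\<^sub>R (\<Sum>i<n. x i) - mean_vec P))"
  shows "prob_space M" and "Y \<in> borel_measurable M" and "integrable M (\<lambda>x. (Y x)\<^sup>2)"
    and "(\<integral>x. Y x \<partial>M) = 0" and "(\<integral>x. (Y x)\<^sup>2 \<partial>M) = (a \<bullet> (cov_mat P *v a)) / real n"
proof -
  have sets_P [measurable_cong]: "sets P = sets borel" and ps: "prob_space P"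
    using P by (auto simp: prob2_def)
  interpret P: prob_space P by fact
  show "prob_space M" unfolding M_def by (intro prob_space_PiM ps)
  then interpret M: prob_space M .
  have comp [measurable]: "(\<lambda>x. x i) \<in> M \<rightarrow>\<^sub>M P" if "i < n" for i
    using that unfolding M_def by (intro measurable_component_singleton) auto
  \<comment> \<open>The factor \<open>1 / n\<close> is absorbed into the direction, so
    \<open>Y\<close> becomes a plain sum of independent terms \<open>f (x i)\<close>. Each variance
    carries a factor \<open>1 / n^2\<close>, and \<open>n\<close> of them add up to a factor
    \<open>1 / n\<close>.\<close>
  define f where "f = (\<lambda>x. (a /\<^sub>R real n) \<bullet> (x - mean_vec P))"
  have f [measurable]: "f \<in> borel_measurable P" unfolding f_def by measurable
  note c = prob2_sq_integrable_centred[OF P, of "mean_vec P"]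
  have f_sq: "integrable P (\<lambda>x. (f x)\<^sup>2)"
    using integrable_inner_mult[OF c c, of "a /\<^sub>R real n" "a /\<^sub>R real n"] by (simp add: f_def power2_eq_square)
  have f_sq_E: "(\<integral>x. (f x)\<^sup>2 \<partial>P) = (a \<bullet> (cov_mat P *v a)) / (real n)\<^sup>2"
    using integral_inner_mult[OF c c, of "a /\<^sub>R real n" "a /\<^sub>R real n"]
    by (simp add: f_def power2_eq_square cov_mat_eq_cross_cov matrix_vector_mult_scaleR field_simps)
  have f_E: "(\<integral>x. f x \<partial>P) = 0"
    using prob2_integral_centred[OF P] sq_integrable_imp_integrable[OF P.finite_measure_axioms c]
    unfolding f_def by simp
  have distr: "distr M P (\<lambda>x. x i) = P" if "i < n" for i
    unfolding M_def using that by (intro distr_PiM_component ps) simp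
  have tr_int: "integrable M (\<lambda>x. g (x i))" and tr_E: "(\<integral>x. g (x i) \<partial>M) = (\<integral>x. g x \<partial>P)"
    if "i < n" "integrable P g" for i and g :: "real ^ 'd \<Rightarrow> real"
  proof -
    have g: "g \<in> borel_measurable P" using that by simp
    show "integrable M (\<lambda>x. g (x i))"
      using integrable_distr[OF comp[OF that(1)], of g] that by (simp add: distr)
    show "(\<integral>x. g (x i) \<partial>M) = (\<integral>x. g x \<partial>P)"
      using integral_distr[OF comp[OF that(1)] g] that by (simp add: distr)
  qed
  have f_int: "integrable P f" by (rule P.square_integrable_imp_integrable[OF f f_sq])
  \<comment> \<open>Since \<open>n \<ge> 1\<close>, the \<open>n\<close> copies of
    \<open>(a \<bullet> mean_vec P) / n\<close> add up to a single
    \<open>a \<bullet> mean_vec P\<close>.\<close>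
  have Y_eq: "Y x = (\<Sum>i<n. f (x i))" for x
  proof -
    have "(\<Sum>i<n. f (x i)) = (\<Sum>i<n. a \<bullet> x i - a \<bullet> mean_vec P) / real n"
      unfolding sum_divide_distrib by (simp add: f_def inner_diff_right divide_inverse right_diff_distrib mult.commute)
    then show ?thesis
      using n by (simp add: Y_def inner_diff_right inner_sum_right sum_subtractf diff_divide_distrib
          sum_divide_distrib)
  qed
  have "M.indep_vars (\<lambda>_. P) (\<lambda>i x. x i) {..<n}"
    unfolding M_def using n by (intro indep_vars_PiM_components ps) (simp add: lessThan_empty_iff)
  then have indep: "M.indep_vars (\<lambda>_. borel) (\<lambda>i x. f (x i)) {..<n}"
    by (rule M.indep_vars_compose2) (rule f)
  show "Y \<in> borel_measurable M"
    unfolding Y_eq[abs_def] by (intro borel_measurable_sum measurable_compose[OF comp f]) simp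
  note sm = M.second_moment_sum_indep[OF _ indep]
  show "integrable M (\<lambda>x. (Y x)\<^sup>2)"
    unfolding Y_eq using tr_int[OF _ f_sq] tr_E[OF _ f_int] f_E by (intro sm) auto
  show "(\<integral>x. Y x \<partial>M) = 0"
    unfolding Y_eq using tr_int[OF _ f_int] tr_E[OF _ f_int] f_E by simp
  have "(\<integral>x. (Y x)\<^sup>2 \<partial>M) = (\<Sum>i<n. \<integral>x. (f (x i))\<^sup>2 \<partial>M)"
    unfolding Y_eq using tr_int[OF _ f_sq] tr_E[OF _ f_int] f_E by (intro sm) auto
  also have "\<dots> = (a \<bullet> (cov_mat P *v a)) / real n"
    using n tr_E[OF _ f_sq] f_sq_E by (simp add: power2_eq_square)
  finally show "(\<integral>x. (Y x)\<^sup>2 \<partial>M) = (a \<bullet> (cov_mat P *v a)) / real n" .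
qed

text \<open>Each output coordinate is a centred function of one sample plus a centred function of
  the other plus a constant bias, hence three summands. The point is that the right-hand side sees
  \<open>P\<close> and \<open>Q\<close> only through their means and covariances.\<close>

lemma mean_sq_error_eq:
  fixes A B :: "real ^ 'd ^ 'd"
  assumes P: "P \<in> prob2" and Q: "Q \<in> prob2" and n: "n \<ge> 1" and N: "N \<ge> 1"
  shows "mean_sq_error n N A B P Q = (\<Sum>i\<in>UNIV. ennreal ((A $ i \<bullet> (cov_mat P *v A $ i)) / real n
      + ((B $ i \<bullet> (cov_mat Q *v B $ i)) / real N + ((A *v mean_vec P + B *v mean_vec Q - mean_vec P) $ i)\<^sup>2)))"
proof -
  let ?MP = "\<Pi>\<^sub>M i\<in>{..<n}. P" and ?MQ = "\<Pi>\<^sub>M j\<in>{..<N}. Q"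
  define Y where "Y = (\<lambda>i x. A $ i \<bullet> ((1 / real n) *\<^sub>R (\<Sum>i<n. x i) - mean_vec P))"
  define Z where "Z = (\<lambda>i z. B $ i \<bullet> ((1 / real N) *\<^sub>R (\<Sum>j<N. z j) - mean_vec Q))"
  define c where "c = A *v mean_vec P + B *v mean_vec Q - mean_vec P"
  have mY: "Y i \<in> borel_measurable ?MP" "integrable ?MP (\<lambda>x. (Y i x)\<^sup>2)" "(\<integral>x. Y i x \<partial>?MP) = 0"
    "(\<integral>x. (Y i x)\<^sup>2 \<partial>?MP) = (A $ i \<bullet> (cov_mat P *v A $ i)) / real n" for i
    unfolding Y_def by (rule sample_mean_moments[OF P n])+
  have mZ: "Z i \<in> borel_measurable ?MQ" "integrable ?MQ (\<lambda>z. (Z i z)\<^sup>2)" "(\<integral>z. Z i z \<partial>?MQ) = 0"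
    "(\<integral>z. (Z i z)\<^sup>2 \<partial>?MQ) = (B $ i \<bullet> (cov_mat Q *v B $ i)) / real N" for i
    unfolding Z_def by (rule sample_mean_moments[OF Q N])+
  interpret MP: prob_space ?MP by (rule sample_mean_moments(1)[OF P n])
  interpret MQ: prob_space ?MQ by (rule sample_mean_moments(1)[OF Q N])
  interpret pair_prob_space ?MP ?MQ ..
  have [measurable]: "Y i \<in> borel_measurable ?MP" "Z i \<in> borel_measurable ?MQ" for i
    by (rule mY mZ)+
  have "(norm (A *v ((1 / real n) *\<^sub>R (\<Sum>i<n. x i)) + B *v ((1 / real N) *\<^sub>R (\<Sum>j<N. z j)) - mean_vec P))\<^sup>2
      = (\<Sum>i\<in>UNIV. (Z i z + (Y i x + c $ i))\<^sup>2)" for x z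
  proof -
    have "(A *v ((1 / real n) *\<^sub>R (\<Sum>i<n. x i)) + B *v ((1 / real N) *\<^sub>R (\<Sum>j<N. z j)) - mean_vec P) $ i
        = Z i z + (Y i x + c $ i)" for i
      by (simp add: Y_def Z_def c_def matrix_vector_mul_component inner_diff_right)
    then show ?thesis unfolding power2_norm_eq_inner inner_vec_def by (simp add: power2_eq_square)
  qed
  then have "mean_sq_error n N A B P Q
      = (\<integral>\<^sup>+(x, z). (\<Sum>i\<in>UNIV. ennreal ((Z i z + (Y i x + c $ i))\<^sup>2)) \<partial>(?MP \<Otimes>\<^sub>M ?MQ))"
    by (simp add: mean_sq_error_def sum_ennreal)
  \<comment> \<open>By Tonelli the second sample is integrated first; for fixed \<open>x\<close>,
    the quantity \<open>Y i x + c $ i\<close> is then a constant shift.\<close>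
  also have "\<dots> = (\<Sum>i\<in>UNIV. \<integral>\<^sup>+x. \<integral>\<^sup>+z. ennreal ((Z i z + (Y i x + c $ i))\<^sup>2) \<partial>?MQ \<partial>?MP)"
    unfolding case_prod_beta
    by (subst nn_integral_sum) (auto intro!: sum.cong simp: MQ.nn_integral_fst[symmetric])
  also have "\<dots> = (\<Sum>i\<in>UNIV. ennreal ((A $ i \<bullet> (cov_mat P *v A $ i)) / real n
      + ((B $ i \<bullet> (cov_mat Q *v B $ i)) / real N + (c $ i)\<^sup>2)))"
  proof (intro sum.cong refl)
    fix i
    define v where "v = (B $ i \<bullet> (cov_mat Q *v B $ i)) / real N"
    \<comment> \<open>Being second moments, both quadratic forms are nonnegative, which lets sums
      pass through \<open>ennreal\<close>.\<close>
    have v: "0 \<le> v" unfolding v_def mZ(4)[symmetric] by simp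
    have w: "0 \<le> (A $ i \<bullet> (cov_mat P *v A $ i)) / real n" unfolding mY(4)[symmetric] by simp
    have "(\<integral>\<^sup>+z. ennreal ((Z i z + k)\<^sup>2) \<partial>?MQ) = ennreal (v + k\<^sup>2)" for k
      using MQ.nn_integral_centred_square[OF mZ(1-3)] by (simp add: mZ(4) v_def)
    then have "(\<integral>\<^sup>+x. \<integral>\<^sup>+z. ennreal ((Z i z + (Y i x + c $ i))\<^sup>2) \<partial>?MQ \<partial>?MP)
        = (\<integral>\<^sup>+x. ennreal v + ennreal ((Y i x + c $ i)\<^sup>2) \<partial>?MP)"
      using v by simp
    also have "\<dots> = ennreal v + ennreal ((A $ i \<bullet> (cov_mat P *v A $ i)) / real n + (c $ i)\<^sup>2)"
      using MP.nn_integral_centred_square[OF mY(1-3)]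
      by (subst nn_integral_add) (auto simp: mY(4) MP.emeasure_space_1)
    also have "\<dots> = ennreal ((A $ i \<bullet> (cov_mat P *v A $ i)) / real n + (v + (c $ i)\<^sup>2))"
      using v w by (subst ennreal_plus[symmetric]) (auto simp: add_ac)
    finally show "(\<integral>\<^sup>+x. \<integral>\<^sup>+z. ennreal ((Z i z + (Y i x + c $ i))\<^sup>2) \<partial>?MQ \<partial>?MP)
        = ennreal ((A $ i \<bullet> (cov_mat P *v A $ i)) / real n + ((B $ i \<bullet> (cov_mat Q *v B $ i)) / real N + (c $ i)\<^sup>2))"
      unfolding v_def .
  qed
  finally show ?thesis unfolding c_def .
qed

subsection \<open>Gaussian couplings\<close>

text \<open>Cholesky elimination: each step subtracts \<open>R k i * R k j / R k k\<close> from the remainder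
  \<open>R\<close>. If \<open>R k k = 0\<close>, the whole row vanishes by positivity, which is consistent with
  \<open>x / 0 = 0\<close>.\<close>

lemma psd_sum_of_squares:
  fixes S :: "'a::finite \<Rightarrow> 'a \<Rightarrow> real"
  assumes sym: "\<And>i j. S i j = S j i"
    and psd: "\<And>t. 0 \<le> (\<Sum>i\<in>UNIV. \<Sum>j\<in>UNIV. t i * S i j * t j)"
  obtains l :: "'a \<Rightarrow> 'a \<Rightarrow> real" where "\<And>i j. S i j = (\<Sum>k\<in>UNIV. l k i * l k j)"
proof -
  define Q where "Q = (\<lambda>R t. \<Sum>i\<in>UNIV. t i * (\<Sum>j\<in>UNIV. R i j * (t (j::'a) :: real)))"
  have delta: "(\<Sum>j\<in>UNIV. of_bool (j = k) * f j) = f k" for k :: 'a and f :: "'a \<Rightarrow> real"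
    by (subst sum.mono_neutral_right[of UNIV "{k}"]) auto
  \<comment> \<open>Moving \<open>t\<close> by \<open>c\<close> along axis \<open>k\<close> changes
    the form by a quadratic polynomial in \<open>c\<close>. This yields the diagonal entries, the
    vanishing of rows and the completion of the square below.\<close>
  have Q_shift: "Q R (\<lambda>i. t i + c * of_bool (i = k))
      = Q R t + 2 * c * (\<Sum>j\<in>UNIV. R k j * t j) + c\<^sup>2 * R k k"
    if R: "\<And>i j. R i j = R j i" for R t c k
  proof -
    have inner: "(\<Sum>j\<in>UNIV. R i j * (t j + c * of_bool (j = k))) = (\<Sum>j\<in>UNIV. R i j * t j) + c * R i k" for i
      using delta[of k "R i"] by (simp add: distrib_left sum.distrib mult.left_commute mult.commute flip: sum_distrib_left)
    have "Q R (\<lambda>i. t i + c * of_bool (i = k)) = (\<Sum>i\<in>UNIV. t i * (\<Sum>j\<in>UNIV. R i j * t j)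
        + c * (R k i * t i) + c * (of_bool (i = k) * ((\<Sum>j\<in>UNIV. R i j * t j) + c * R i k)))"
      unfolding Q_def inner by (intro sum.cong refl) (simp add: R[of k] algebra_simps)
    also have "\<dots> = Q R t + c * (\<Sum>j\<in>UNIV. R k j * t j) + c * ((\<Sum>j\<in>UNIV. R k j * t j) + c * R k k)"
      unfolding sum.distrib Q_def by (simp only: delta flip: sum_distrib_left)
    finally show ?thesis by (simp add: algebra_simps power2_eq_square)
  qed
  \<comment> \<open>Invariant of the elimination: the remainder stays positive semidefinite and its
    rows in \<open>J\<close> are zero. At \<open>J = UNIV\<close> the remainder vanishes, which is
    the factorisation.\<close>
  have ex: "\<exists>l :: 'a \<Rightarrow> 'a \<Rightarrow> real. let R = (\<lambda>i j. S i j - (\<Sum>k\<in>J. l k i * l k j)) in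
      (\<forall>t. 0 \<le> Q R t) \<and> (\<forall>i\<in>J. \<forall>j. R i j = 0)" for J
  proof (induction J rule: finite_induct[OF finite])
    case 1
    then show ?case using psd by (simp add: Q_def sum_distrib_left mult.assoc)
  next
    case (2 k J)
    then obtain l :: "'a \<Rightarrow> 'a \<Rightarrow> real" where l: "let R = (\<lambda>i j. S i j - (\<Sum>k\<in>J. l k i * l k j)) in
      (\<forall>t. 0 \<le> Q R t) \<and> (\<forall>i\<in>J. \<forall>j. R i j = 0)" by blast
    define R where "R = (\<lambda>i j. S i j - (\<Sum>k\<in>J. l k i * l k j))"
    have R_psd: "0 \<le> Q R t" and R0: "i \<in> J \<Longrightarrow> R i j = 0" for t i j
      using l unfolding R_def Let_def by blast+
    have R_sym: "R i j = R j i" for i j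
      by (simp add: R_def sym[of i] mult.commute)
    have Q_axis: "Q R (\<lambda>j. of_bool (j = i)) = R i i" for i
      using Q_shift[where R = R and t = "\<lambda>_. 0" and c = 1 and k = i, OF R_sym] by (simp add: Q_def)
    have Rkk: "0 \<le> R k k" using R_psd[of "\<lambda>j. of_bool (j = k)"] Q_axis by simp
    have Rk0: "R k i = 0" if "R k k = 0" for i
    proof (rule ccontr)
      assume nz: "R k i \<noteq> 0"
      \<comment> \<open>With \<open>R k k = 0\<close> the form is affine in the shift along axis
        \<open>k\<close>; the shift chosen here gives it the value -1.\<close>
      have "0 \<le> R i i + 2 * (- (R i i + 1) / (2 * R k i)) * R k i"
        using R_psd[of "\<lambda>j. of_bool (j = i) + (- (R i i + 1) / (2 * R k i)) * of_bool (j = k)"] that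
        by (subst (asm) Q_shift[where R = R, OF R_sym]) (simp add: Q_axis delta mult.commute[of "R k _"])
      with nz show False by (simp add: field_simps)
    qed
    define R' where "R' = (\<lambda>i j. R i j - R k i * R k j / R k k)"
    define l' where "l' = l(k := \<lambda>i. R k i / sqrt (R k k))"
    have R'_eq: "R' = (\<lambda>i j. S i j - (\<Sum>k\<in>insert k J. l' k i * l' k j))"
    proof (intro ext)
      fix i j
      have "(\<Sum>k\<in>J. l' k i * l' k j) = (\<Sum>k\<in>J. l k i * l k j)"
        using 2 by (intro sum.cong) (auto simp: l'_def)
      then show "R' i j = S i j - (\<Sum>k\<in>insert k J. l' k i * l' k j)"
        using 2 Rkk by (simp add: R'_def R_def l'_def)
    qed
    have "0 \<le> Q R' t" for t
    proof -
      let ?b = "\<Sum>j\<in>UNIV. R k j * t j"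
      have row: "(\<Sum>j\<in>UNIV. R' i j * t j) = (\<Sum>j\<in>UNIV. R i j * t j) - R k i * ?b / R k k" for i
        by (simp add: R'_def left_diff_distrib sum_subtractf sum_distrib_left sum_divide_distrib mult.assoc)
      have "Q R' t = (\<Sum>i\<in>UNIV. t i * (\<Sum>j\<in>UNIV. R i j * t j) - (R k i * t i) * (?b / R k k))"
        unfolding Q_def row by (simp add: right_diff_distrib mult.assoc mult.left_commute)
      also have "\<dots> = Q R t - ?b\<^sup>2 / R k k"
        unfolding sum_subtractf Q_def sum_distrib_right[symmetric] by (simp add: power2_eq_square)
      \<comment> \<open>Completing the square: the reduced form at \<open>t\<close> is the old form
        at a shifted point. If \<open>R k k = 0\<close>, the quotients are 0 and the shift
        disappears.\<close>
      also have "\<dots> = Q R (\<lambda>i. t i + (- ?b / R k k) * of_bool (i = k))"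
        by (subst Q_shift[where R = R, OF R_sym]) (auto simp: field_simps power2_eq_square)
      finally show ?thesis using R_psd by simp
    qed
    \<comment> \<open>For \<open>i\<close> in \<open>J\<close>, symmetry gives
      \<open>R k i = R i k = 0\<close>, so rows already cleared stay cleared.\<close>
    moreover have "R' i j = 0" if "i \<in> insert k J" for i j
      using that R0 Rk0 R_sym[of k i] by (auto simp: R'_def)
    ultimately show ?case unfolding Let_def R'_eq by (intro exI[of _ l']) auto
  qed
  from ex[of UNIV] show thesis by (auto simp: Let_def intro: that)
qed

section \<open>Moments and construction of multivariate Gaussian laws\<close>

lemma prob2_second_moment:
  assumes "P \<in> prob2"
  shows "(\<integral>x. (norm x)\<^sup>2 \<partial>P) = (norm (mean_vec P))\<^sup>2 + trace (cov_mat P)"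
proof -
  interpret prob_space P using assms by (simp add: prob2_def)
  let ?f = "\<lambda>x. x - mean_vec P"
  note c = prob2_sq_integrable_centred[OF assms, of "mean_vec P"]
  note i = sq_integrable_imp_integrable[OF finite_measure_axioms c]
  have eq: "(norm x)\<^sup>2 = ?f x \<bullet> ?f x + 2 * (mean_vec P \<bullet> ?f x) + (norm (mean_vec P))\<^sup>2" for x
    unfolding power2_norm_eq_inner by (simp add: inner_diff_left inner_diff_right inner_commute)
  have "(\<integral>x. (norm x)\<^sup>2 \<partial>P)
      = (\<integral>x. ?f x \<bullet> ?f x + 2 * (mean_vec P \<bullet> ?f x) + (norm (mean_vec P))\<^sup>2 \<partial>P)"
    by (rule Bochner_Integration.integral_cong[OF refl eq])
  also have "\<dots> = trace (cov_mat P) + 2 * (mean_vec P \<bullet> (\<integral>x. ?f x \<partial>P)) + (norm (mean_vec P))\<^sup>2"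
    using i integrable_inner_cross[OF c c] integral_inner_cross[OF c c]
    by (simp add: prob_space cov_mat_eq_cross_cov del: integral_diff)
  finally show ?thesis by (simp add: prob2_integral_centred[OF assms])
qed

text \<open>Polarisation. Variances of projections reveal only a quadratic form; by symmetry this
  determines the whole covariance matrix.\<close>

lemma symmetric_matrix_eqI:
  fixes S T :: "real ^ 'd ^ 'd"
  assumes "transpose S = S" "transpose T = T" and eq: "\<And>t. t \<bullet> (S *v t) = t \<bullet> (T *v t)"
  shows "S = T"
proof -
  have polar: "2 * (s \<bullet> (R *v t)) = (s + t) \<bullet> (R *v (s + t)) - s \<bullet> (R *v s) - t \<bullet> (R *v t)"
    if "transpose R = R" for R :: "real ^ 'd ^ 'd" and s t
  proof -
    have "t \<bullet> (R *v s) = s \<bullet> (R *v t)"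
      using that by (metis dot_lmul_matrix inner_commute transpose_matrix_vector)
    then show ?thesis by (simp add: matrix_vector_right_distrib inner_add_left inner_add_right)
  qed
  have "s \<bullet> (S *v t) = s \<bullet> (T *v t)" for s t
    using polar[OF assms(1), of s t] polar[OF assms(2), of s t] eq by simp
  then have "S *v t = T *v t" for t by (rule vector_eq_ldot[THEN iffD1, OF allI])
  then show ?thesis by (simp add: matrix_eq)
qed

text \<open>The normal projections supply mean and variance in every direction \<open>t\<close>.
  Coordinate directions give square integrability; all directions together give the mean vector and,
  by polarisation, the covariance.\<close>

lemma
  fixes P :: "(real ^ 'd) measure"
  assumes normal: "is_normal_law m S P"
  shows is_normal_law_prob2: "P \<in> prob2"
    and is_normal_law_mean: "mean_vec P = m"
    and is_normal_law_cov: "cov_mat P = S"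
proof -
  have sets_P [measurable_cong]: "sets P = sets borel" and ps: "prob_space P"
    and sym: "transpose S = S" and psd: "0 \<le> t \<bullet> (S *v t)"
    and proj: "distr P borel (\<lambda>x. t \<bullet> x) = normal_law1 (t \<bullet> m) (t \<bullet> (S *v t))" for t
    using normal by (auto simp: is_normal_law_def)
  interpret prob_space P by fact
  have sq: "integrable P (\<lambda>x. (t \<bullet> x - c)\<^sup>2)" and sq_E: "(\<integral>x. (t \<bullet> x - c)\<^sup>2 \<partial>P) = t \<bullet> (S *v t) + (t \<bullet> m - c)\<^sup>2"
    and lin_E: "(\<integral>x. t \<bullet> x \<partial>P) = t \<bullet> m" for t c
  proof -
    have [measurable]: "(\<lambda>x. t \<bullet> x) \<in> borel_measurable P" by measurable
    show "integrable P (\<lambda>x. (t \<bullet> x - c)\<^sup>2)"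
      using integrable_normal_law1_square[OF psd[of t], of "t \<bullet> m" c] unfolding proj[symmetric]
      by (subst (asm) integrable_distr_eq) auto
    show "(\<integral>x. (t \<bullet> x - c)\<^sup>2 \<partial>P) = t \<bullet> (S *v t) + (t \<bullet> m - c)\<^sup>2"
      using integral_normal_law1_square[OF psd[of t], of "t \<bullet> m" c] unfolding proj[symmetric]
      by (subst (asm) integral_distr) auto
    show "(\<integral>x. t \<bullet> x \<partial>P) = t \<bullet> m"
      using integral_normal_law1[OF psd[of t], of "t \<bullet> m"] unfolding proj[symmetric]
      by (subst (asm) integral_distr) auto
  qed
  have "integrable P (\<lambda>x. (x $ i)\<^sup>2)" for i
    using sq[of "axis i 1" 0] by (simp add: inner_axis')
  then have "integrable P (\<lambda>x. (norm x)\<^sup>2)"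
    unfolding power2_norm_eq_inner inner_vec_def by (simp add: power2_eq_square)
  with ps sets_P show P2: "P \<in> prob2" by (simp add: prob2_def)
  have "integrable P (\<lambda>x. x)"
    using sq_integrable_imp_integrable[OF finite_measure_axioms prob2_sq_integrable_centred[OF P2, of 0]] by simp
  then have "t \<bullet> mean_vec P = t \<bullet> m" for t
    using lin_E[of t] by (simp add: mean_vec_def)
  then show mean: "mean_vec P = m" by (rule vector_eq_ldot[THEN iffD1, OF allI])
  note c = prob2_sq_integrable_centred[OF P2, of m]
  show "cov_mat P = S"
  proof (rule symmetric_matrix_eqI)
    show "transpose (cov_mat P) = cov_mat P"
      by (simp add: transpose_def cov_mat_def mult.commute)
    show "t \<bullet> (cov_mat P *v t) = t \<bullet> (S *v t)" for t
      using sq_E[of t "t \<bullet> m"] integral_inner_mult[OF c c, of t t]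
      by (simp add: cov_mat_eq_cross_cov mean inner_diff_right power2_eq_square)
  qed fact
qed

text \<open>Each projection is affine in independent standard normals with coefficients
  \<open>t \<bullet> L k\<close>, whose squares add up to the quadratic form of \<open>S\<close>.
  The vectors \<open>L k\<close> may be linearly dependent, so singular \<open>S\<close> is
  covered.\<close>

lemma is_normal_law_distr_std_gauss:
  fixes L :: "'k::finite \<Rightarrow> real ^ 'd"
  assumes S: "\<And>i j. S $ i $ j = (\<Sum>k\<in>UNIV. L k $ i * L k $ j)"
  shows "is_normal_law m S (distr std_gauss borel (\<lambda>\<omega>. m + (\<Sum>k\<in>UNIV. \<omega> k *\<^sub>R L k)))"
proof -
  interpret prob_space "std_gauss :: ('k \<Rightarrow> real) measure" by (rule prob_space_std_gauss)
  have quad: "t \<bullet> (S *v t) = (\<Sum>k\<in>UNIV. (t \<bullet> L k)\<^sup>2)" for t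
  proof -
    have "t \<bullet> (S *v t) = (\<Sum>i\<in>UNIV. \<Sum>j\<in>UNIV. \<Sum>k\<in>UNIV. (t $ i * L k $ i) * (t $ j * L k $ j))"
      by (simp add: inner_vec_def matrix_vector_mult_def S sum_distrib_left sum_distrib_right mult_ac)
    also have "\<dots> = (\<Sum>i\<in>UNIV. \<Sum>k\<in>UNIV. \<Sum>j\<in>UNIV. (t $ i * L k $ i) * (t $ j * L k $ j))"
      by (intro sum.cong refl sum.swap)
    also have "\<dots> = (\<Sum>k\<in>UNIV. \<Sum>i\<in>UNIV. \<Sum>j\<in>UNIV. (t $ i * L k $ i) * (t $ j * L k $ j))"
      by (rule sum.swap)
    finally show ?thesis by (simp add: inner_vec_def power2_eq_square sum_product)
  qed
  have [measurable]: "(\<lambda>\<omega>. m + (\<Sum>k\<in>UNIV. \<omega> k *\<^sub>R L k)) \<in> borel_measurable std_gauss"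
    by measurable
  have "distr (distr std_gauss borel (\<lambda>\<omega>. m + (\<Sum>k\<in>UNIV. \<omega> k *\<^sub>R L k))) borel (\<lambda>x. t \<bullet> x)
      = normal_law1 (t \<bullet> m) (t \<bullet> (S *v t))" for t
    using distr_std_gauss_affine[of "t \<bullet> m" "\<lambda>k. t \<bullet> L k"]
    by (subst distr_distr) (simp_all add: quad comp_def inner_add_right inner_sum_right mult.commute)
  moreover have "transpose S = S"
    by (simp add: transpose_def vec_eq_iff S mult.commute)
  moreover have "0 \<le> t \<bullet> (S *v t)" for t unfolding quad by (simp add: sum_nonneg)
  ultimately show ?thesis by (simp add: is_normal_law_def prob_space_distr)
qed

text \<open>By \<open>psd\<close>, the block matrix formed from \<open>S\<close>, \<open>C\<close>,
  the transpose of \<open>C\<close>, and \<open>T\<close> is positive semidefinite, hence factors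
  into vectors with halves \<open>L k\<close> and \<open>K k\<close>. Driving both halves by the
  same standard Gaussian vector produces the cross-covariance \<open>C\<close>.\<close>

lemma gaussian_coupling_exists:
  fixes S T C :: "real ^ 'd ^ 'd"
  assumes S: "transpose S = S" and T: "transpose T = T"
    and psd: "\<And>s t. 0 \<le> s \<bullet> (S *v s) + 2 * (s \<bullet> (C *v t)) + t \<bullet> (T *v t)"
  obtains P Q \<gamma> where "is_normal_law m S P" "is_normal_law m' T Q" "\<gamma> \<in> couplings P Q"
    "(\<integral>(x, y). (norm (x - y))\<^sup>2 \<partial>\<gamma>) = (norm (m - m'))\<^sup>2 + trace S + trace T - 2 * trace C"
proof -
  define J where "J = (\<lambda>p q. case p of
      Inl i \<Rightarrow> (case q of Inl j \<Rightarrow> S $ i $ j | Inr j \<Rightarrow> C $ i $ j)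
    | Inr i \<Rightarrow> (case q of Inl j \<Rightarrow> C $ j $ i | Inr j \<Rightarrow> T $ i $ j))"
  have sum_Plus: "(\<Sum>p\<in>UNIV. f p) = (\<Sum>i\<in>UNIV. f (Inl i)) + (\<Sum>i\<in>UNIV. f (Inr i))"
    for f :: "'d + 'd \<Rightarrow> real"
    using sum.Plus[of UNIV UNIV f] by (simp add: comp_def)
  have SS: "S $ i $ j = S $ j $ i" and TT: "T $ i $ j = T $ j $ i" for i j
    using arg_cong[OF S, of "\<lambda>R. R $ j $ i"] arg_cong[OF T, of "\<lambda>R. R $ j $ i"]
    by (simp_all add: transpose_def)
  have J_sym: "J p q = J q p" for p q
    by (cases p; cases q) (auto simp: J_def SS TT)
  have J_psd: "0 \<le> (\<Sum>p\<in>UNIV. \<Sum>q\<in>UNIV. u p * J p q * u q)" for u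
  proof -
    define s t where "s = (\<chi> i. u (Inl i))" and "t = (\<chi> i. u (Inr i))"
    have "(\<Sum>p\<in>UNIV. \<Sum>q\<in>UNIV. u p * J p q * u q) =
        s \<bullet> (S *v s) + s \<bullet> (C *v t) + (\<Sum>i\<in>UNIV. \<Sum>j\<in>UNIV. t $ i * C $ j $ i * s $ j) + t \<bullet> (T *v t)"
      by (simp add: sum_Plus J_def s_def t_def inner_vec_def matrix_vector_mult_def sum_distrib_left
          sum.distrib mult.assoc)
    also have "(\<Sum>i\<in>UNIV. \<Sum>j\<in>UNIV. t $ i * C $ j $ i * s $ j) = s \<bullet> (C *v t)"
      by (subst sum.swap) (simp add: inner_vec_def matrix_vector_mult_def sum_distrib_left mult_ac)
    finally show ?thesis using psd[of s t] by simp
  qed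
  obtain l :: "'d + 'd \<Rightarrow> 'd + 'd \<Rightarrow> real" where l: "\<And>p q. J p q = (\<Sum>k\<in>UNIV. l k p * l k q)"
    using psd_sum_of_squares[of J, OF J_sym J_psd] by blast
  define L K where "L = (\<lambda>k. \<chi> i. l k (Inl i))" and "K = (\<lambda>k. \<chi> i. l k (Inr i))"
  have SL: "S $ i $ j = (\<Sum>k\<in>UNIV. L k $ i * L k $ j)" for i j
    using l[of "Inl i" "Inl j"] by (simp add: J_def L_def)
  have TK: "T $ i $ j = (\<Sum>k\<in>UNIV. K k $ i * K k $ j)" for i j
    using l[of "Inr i" "Inr j"] by (simp add: J_def K_def)
  have CLK: "C $ i $ j = (\<Sum>k\<in>UNIV. L k $ i * K k $ j)" for i j
    using l[of "Inl i" "Inr j"] by (simp add: J_def L_def K_def)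
  define X Y where "X = (\<lambda>\<omega>. m + (\<Sum>k\<in>UNIV. \<omega> k *\<^sub>R L k))" and "Y = (\<lambda>\<omega>. m' + (\<Sum>k\<in>UNIV. \<omega> k *\<^sub>R K k))"
  define D where "D = (\<chi> i j. \<Sum>k\<in>UNIV. (L k - K k) $ i * (L k - K k) $ j)"
  have [measurable]: "X \<in> borel_measurable std_gauss" "Y \<in> borel_measurable std_gauss"
    unfolding X_def Y_def by measurable
  interpret prob_space "std_gauss :: ('d + 'd \<Rightarrow> real) measure" by (rule prob_space_std_gauss)
  define \<gamma> where "\<gamma> = distr std_gauss (borel \<Otimes>\<^sub>M borel) (\<lambda>\<omega>. (X \<omega>, Y \<omega>))"
  \<comment> \<open>The difference is again an affine image of the standard Gaussian vector, so the
    cost is the second moment of a normal law and can be read off from the trace of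
    \<open>D\<close>.\<close>
  have D_normal: "is_normal_law (m - m') D (distr std_gauss borel (\<lambda>\<omega>. X \<omega> - Y \<omega>))"
    using is_normal_law_distr_std_gauss[of D "\<lambda>k. L k - K k" "m - m'"]
    by (simp add: D_def X_def Y_def algebra_simps sum_subtractf)
  have "(\<integral>(x, y). (norm (x - y))\<^sup>2 \<partial>\<gamma>) = (\<integral>\<omega>. (norm (X \<omega> - Y \<omega>))\<^sup>2 \<partial>std_gauss)"
    unfolding \<gamma>_def by (subst integral_distr) (auto simp: case_prod_beta)
  also have "\<dots> = (\<integral>z. (norm z)\<^sup>2 \<partial>distr std_gauss borel (\<lambda>\<omega>. X \<omega> - Y \<omega>))"
    by (subst integral_distr) auto
  also have "\<dots> = (norm (m - m'))\<^sup>2 + trace D"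
    using prob2_second_moment[OF is_normal_law_prob2[OF D_normal]]
    by (simp add: is_normal_law_mean[OF D_normal] is_normal_law_cov[OF D_normal])
  also have "trace D = trace S + trace T - 2 * trace C"
    by (simp add: trace_def D_def SL TK CLK algebra_simps sum.distrib sum_subtractf flip: sum_distrib_left)
  finally have cost: "(\<integral>(x, y). (norm (x - y))\<^sup>2 \<partial>\<gamma>) = (norm (m - m'))\<^sup>2 + trace S + trace T - 2 * trace C"
    by simp
  have "\<gamma> \<in> couplings (distr std_gauss borel X) (distr std_gauss borel Y)"
    by (simp add: couplings_def \<gamma>_def prob_space_distr distr_distr comp_def)
  from that[OF _ _ this cost] show thesis
    using is_normal_law_distr_std_gauss[OF SL] is_normal_law_distr_std_gauss[OF TK]
    by (simp add: X_def Y_def)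
qed

subsection \<open>Reduction to Gaussian pairs\<close>

text \<open>The independent coupling shows that the infimum defining \<open>wasserstein2\<close>
  ranges over a nonempty set, so near-optimal couplings exist.\<close>

lemma pair_measure_in_couplings:
  assumes "P \<in> prob2" "Q \<in> prob2"
  shows "P \<Otimes>\<^sub>M Q \<in> couplings P Q"
proof -
  have [measurable_cong]: "sets P = sets borel" "sets Q = sets borel"
    using assms by (auto simp: prob2_def)
  interpret p: prob_space P using assms by (simp add: prob2_def)
  interpret q: prob_space Q using assms by (simp add: prob2_def)
  interpret pair_prob_space P Q ..
  have "distr (P \<Otimes>\<^sub>M Q) borel fst = distr (P \<Otimes>\<^sub>M Q) P fst"
    by (intro distr_cong) (use assms in \<open>auto simp: prob2_def\<close>)
  also have "\<dots> = P" by (rule q.distr_pair_fst)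
  finally have fst: "distr (P \<Otimes>\<^sub>M Q) borel fst = P" .
  have "distr (P \<Otimes>\<^sub>M Q) borel snd = Q"
  proof (rule measure_eqI)
    fix A assume A: "A \<in> sets (distr (P \<Otimes>\<^sub>M Q) borel snd)"
    then have [measurable]: "A \<in> sets Q" using assms by (simp add: prob2_def)
    have "emeasure (distr (P \<Otimes>\<^sub>M Q) borel snd) A = emeasure (P \<Otimes>\<^sub>M Q) (snd -` A \<inter> space (P \<Otimes>\<^sub>M Q))"
      using A by (intro emeasure_distr) auto
    also have "snd -` A \<inter> space (P \<Otimes>\<^sub>M Q) = space P \<times> A"
      using sets.sets_into_space[OF \<open>A \<in> sets Q\<close>] by (auto simp: space_pair_measure)
    finally show "emeasure (distr (P \<Otimes>\<^sub>M Q) borel snd) A = emeasure Q A"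
      by (simp add: q.emeasure_pair_measure_Times p.emeasure_space_1)
  qed (use assms in \<open>simp add: prob2_def\<close>)
  with fst show ?thesis
    by (auto simp: couplings_def p.prob_space_axioms prob_space_axioms intro!: sets_pair_measure_cong)
       (use assms in \<open>auto simp: prob2_def\<close>)
qed

text \<open>The first part expands the nonnegative second moment of a combination of the two centred
  components. For the second, the cost is expanded around the means and the linear terms integrate
  to zero.\<close>

lemma coupling_cross_cov:
  fixes P Q :: "(real ^ 'd) measure"
  assumes P: "P \<in> prob2" and Q: "Q \<in> prob2" and \<gamma>: "\<gamma> \<in> couplings P Q"
  defines "C \<equiv> cross_cov \<gamma> (\<lambda>p. fst p - mean_vec P) (\<lambda>p. snd p - mean_vec Q)"
  shows "0 \<le> s \<bullet> (cov_mat P *v s) + 2 * (s \<bullet> (C *v t)) + t \<bullet> (cov_mat Q *v t)"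
    and "(\<integral>(x, y). (norm (x - y))\<^sup>2 \<partial>\<gamma>)
      = (norm (mean_vec P - mean_vec Q))\<^sup>2 + trace (cov_mat P) + trace (cov_mat Q) - 2 * trace C"
proof -
  interpret prob_space \<gamma> using \<gamma> by (simp add: couplings_def)
  have [measurable_cong]: "sets \<gamma> = sets (borel \<Otimes>\<^sub>M borel)" and fst: "distr \<gamma> borel fst = P" and snd: "distr \<gamma> borel snd = Q"
    using \<gamma> by (auto simp: couplings_def)
  have [measurable]: "fst \<in> borel_measurable \<gamma>" "snd \<in> borel_measurable \<gamma>" by measurable
  let ?f = "\<lambda>p. fst p - mean_vec P" and ?g = "\<lambda>p. snd p - mean_vec Q"
  have f: "sq_integrable \<gamma> ?f"
    using sq_integrable_distr[of fst \<gamma> borel "\<lambda>x. x - mean_vec P"] prob2_sq_integrable_centred[OF P] by (simp add: fst)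
  have g: "sq_integrable \<gamma> ?g"
    using sq_integrable_distr[of snd \<gamma> borel "\<lambda>x. x - mean_vec Q"] prob2_sq_integrable_centred[OF Q] by (simp add: snd)
  \<comment> \<open>Only the integrating measure \<open>P\<close> is rewritten as a push-forward of
    \<open>\<gamma>\<close>; the centre \<open>mean_vec P\<close> stays.\<close>
  have ff: "cross_cov \<gamma> ?f ?f = cov_mat P"
    unfolding cov_mat_def cross_cov_def by (subst (3) fst[symmetric]) (simp add: integral_distr)
  have gg: "cross_cov \<gamma> ?g ?g = cov_mat Q"
    unfolding cov_mat_def cross_cov_def by (subst (3) snd[symmetric]) (simp add: integral_distr)
  have f0: "(\<integral>p. ?f p \<partial>\<gamma>) = 0"
    using prob2_integral_centred[OF P] by (subst (asm) (1) fst[symmetric]) (simp add: integral_distr del: integral_diff)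
  have g0: "(\<integral>p. ?g p \<partial>\<gamma>) = 0"
    using prob2_integral_centred[OF Q] by (subst (asm) (1) snd[symmetric]) (simp add: integral_distr del: integral_diff)
  have "0 \<le> (\<integral>p. (s \<bullet> ?f p + t \<bullet> ?g p)\<^sup>2 \<partial>\<gamma>)" by simp
  also have "\<dots> = (\<integral>p. (s \<bullet> ?f p) * (s \<bullet> ?f p) + 2 * ((s \<bullet> ?f p) * (t \<bullet> ?g p)) + (t \<bullet> ?g p) * (t \<bullet> ?g p) \<partial>\<gamma>)"
    by (intro Bochner_Integration.integral_cong refl) (simp add: power2_eq_square algebra_simps)
  also have "\<dots> = s \<bullet> (cov_mat P *v s) + 2 * (s \<bullet> (C *v t)) + t \<bullet> (cov_mat Q *v t)"
    using integrable_inner_mult[OF f f, of s s] integrable_inner_mult[OF f g, of s t] integrable_inner_mult[OF g g, of t t]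
    by (simp add: integral_inner_mult[OF f f, of s s, unfolded ff] integral_inner_mult[OF g g, of t t, unfolded gg]
        integral_inner_mult[OF f g, of s t, folded C_def])
  finally show "0 \<le> s \<bullet> (cov_mat P *v s) + 2 * (s \<bullet> (C *v t)) + t \<bullet> (cov_mat Q *v t)" .
  let ?c = "mean_vec P - mean_vec Q"
  note fi = sq_integrable_imp_integrable[OF finite_measure_axioms f]
  note gi = sq_integrable_imp_integrable[OF finite_measure_axioms g]
  have split: "(\<integral>p. k + a p + b p - 2 * c p + 2 * d p - 2 * e p \<partial>\<gamma>) = k + (\<integral>p. a p \<partial>\<gamma>) + (\<integral>p. b p \<partial>\<gamma>)
      - 2 * (\<integral>p. c p \<partial>\<gamma>) + 2 * (\<integral>p. d p \<partial>\<gamma>) - 2 * (\<integral>p. e p \<partial>\<gamma>)"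
    if "integrable \<gamma> a" "integrable \<gamma> b" "integrable \<gamma> c" "integrable \<gamma> d" "integrable \<gamma> e"
    for k :: real and a b c d e
    using that by (simp add: prob_space)
  have "(norm (fst p - snd p))\<^sup>2 = (norm ?c)\<^sup>2 + ?f p \<bullet> ?f p + ?g p \<bullet> ?g p - 2 * (?f p \<bullet> ?g p)
      + 2 * (?c \<bullet> ?f p) - 2 * (?c \<bullet> ?g p)" for p
    unfolding power2_norm_eq_inner by (simp add: inner_diff_left inner_diff_right inner_commute)
  then have "(\<integral>(x, y). (norm (x - y))\<^sup>2 \<partial>\<gamma>) = (\<integral>p. (norm ?c)\<^sup>2 + ?f p \<bullet> ?f p + ?g p \<bullet> ?g p - 2 * (?f p \<bullet> ?g p)
      + 2 * (?c \<bullet> ?f p) - 2 * (?c \<bullet> ?g p) \<partial>\<gamma>)"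
    by (intro Bochner_Integration.integral_cong refl) (simp add: case_prod_beta)
  also have "\<dots> = (norm ?c)\<^sup>2 + (\<integral>p. ?f p \<bullet> ?f p \<partial>\<gamma>) + (\<integral>p. ?g p \<bullet> ?g p \<partial>\<gamma>) - 2 * (\<integral>p. ?f p \<bullet> ?g p \<partial>\<gamma>)
      + 2 * (\<integral>p. ?c \<bullet> ?f p \<partial>\<gamma>) - 2 * (\<integral>p. ?c \<bullet> ?g p \<partial>\<gamma>)"
    by (rule split) (intro integrable_inner_cross f g integrable_inner_right fi gi)+
  also have "(\<integral>p. ?c \<bullet> ?f p \<partial>\<gamma>) = 0" using integral_inner_right[OF fi, of ?c] unfolding f0 by simp
  also have "(\<integral>p. ?c \<bullet> ?g p \<partial>\<gamma>) = 0" using integral_inner_right[OF gi, of ?c] unfolding g0 by simp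
  also have "(\<integral>p. ?f p \<bullet> ?f p \<partial>\<gamma>) = trace (cov_mat P)" unfolding integral_inner_cross[OF f f] ff ..
  also have "(\<integral>p. ?g p \<bullet> ?g p \<partial>\<gamma>) = trace (cov_mat Q)" unfolding integral_inner_cross[OF g g] gg ..
  also have "(\<integral>p. ?f p \<bullet> ?g p \<partial>\<gamma>) = trace C" unfolding integral_inner_cross[OF f g] C_def ..
  finally show "(\<integral>(x, y). (norm (x - y))\<^sup>2 \<partial>\<gamma>)
      = (norm (mean_vec P - mean_vec Q))\<^sup>2 + trace (cov_mat P) + trace (cov_mat Q) - 2 * trace C"
    by simp
qed

lemma wasserstein2_le:
  assumes "\<gamma> \<in> couplings P Q"
  shows "wasserstein2 P Q \<le> sqrt (\<integral>(x, y). (norm (x - y))\<^sup>2 \<partial>\<gamma>)"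
  unfolding wasserstein2_def using assms
  by (intro cINF_lower bdd_belowI[of _ 0]) (auto simp: case_prod_beta)

text \<open>An inequality between the distances suffices, since feasibility only bounds the distance
  from above. The admissible cross-covariances form a closed and bounded set, so near-optimal ones
  have a limit point.\<close>

lemma gaussian_pair_exists:
  fixes P Q :: "(real ^ 'd) measure"
  assumes P: "P \<in> prob2" and Q: "Q \<in> prob2"
  obtains P' Q' where "is_normal_law (mean_vec P) (cov_mat P) P'" "is_normal_law (mean_vec Q) (cov_mat Q) Q'"
    "wasserstein2 P' Q' \<le> wasserstein2 P Q"
proof -
  let ?S = "cov_mat P" and ?T = "cov_mat Q" and ?w = "wasserstein2 P Q"
  define cost where "cost = (\<lambda>C :: real ^ 'd ^ 'd.
    (norm (mean_vec P - mean_vec Q))\<^sup>2 + trace ?S + trace ?T - 2 * trace C)"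
  have "\<exists>C. (\<forall>s t. 0 \<le> s \<bullet> (?S *v s) + 2 * (s \<bullet> (C *v t)) + t \<bullet> (?T *v t))
      \<and> sqrt (cost C) \<le> ?w + 1 / real (Suc k)" for k
  proof -
    \<comment> \<open>\<open>G\<close> collects the transport costs, with infimum \<open>?w\<close>;
      exceeding the infimum by \<open>1 / (k + 1)\<close> leaves room for an actual
      coupling.\<close>
    define G where "G = (\<lambda>\<gamma>. sqrt (\<integral>(x, y). (norm (x - y))\<^sup>2 \<partial>\<gamma>)) ` couplings P Q"
    have "Inf G < ?w + 1 / real (Suc k)" by (simp add: wasserstein2_def G_def)
    moreover have "G \<noteq> {}" using pair_measure_in_couplings[OF P Q] by (auto simp: G_def)
    ultimately obtain \<gamma> where \<gamma>: "\<gamma> \<in> couplings P Q"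
      and *: "sqrt (\<integral>(x, y). (norm (x - y))\<^sup>2 \<partial>\<gamma>) < ?w + 1 / real (Suc k)"
      using cInf_lessD[of G] unfolding G_def by blast
    from coupling_cross_cov[OF P Q \<gamma>] * show ?thesis
      unfolding cost_def by (metis less_imp_le)
  qed
  then obtain C where psd: "\<And>k s t. 0 \<le> s \<bullet> (?S *v s) + 2 * (s \<bullet> (C k *v t)) + t \<bullet> (?T *v t)"
    and cost: "\<And>k. sqrt (cost (C k)) \<le> ?w + 1 / real (Suc k)" by metis
  \<comment> \<open>Testing positivity on the basis vectors \<open>e_i\<close> and plus or minus
    \<open>e_j\<close> even gives half of this bound; the cruder one is enough for
    boundedness.\<close>
  have entry: "\<bar>C k $ i $ j\<bar> \<le> ?S $ i $ i + ?T $ j $ j" for k i j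
  proof -
    have ax: "axis a 1 \<bullet> (R *v axis b 1) = R $ a $ b" for R :: "real ^ 'd ^ 'd" and a b
      by (simp add: inner_axis' matrix_vector_mult_basis column_def)
    have "R *v - v = - (R *v v)" for R :: "real ^ 'd ^ 'd" and v
      using matrix_vector_mult_scaleR[of R "-1" v] by simp
    then show ?thesis
      using psd[of "axis i 1" k "axis j 1"] psd[of "axis i 1" k "- axis j 1"] by (simp add: ax)
  qed
  have "norm (C k) \<le> (\<Sum>i\<in>UNIV. \<Sum>j\<in>UNIV. ?S $ i $ i + ?T $ j $ j)" for k
  proof -
    have "norm (C k) \<le> (\<Sum>i\<in>UNIV. norm (C k $ i))"
      unfolding norm_vec_def[of "C k"] by (rule L2_set_le_sum) simp
    also have "\<dots> \<le> (\<Sum>i\<in>UNIV. \<Sum>j\<in>UNIV. \<bar>C k $ i $ j\<bar>)"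
      by (intro sum_mono norm_le_l1_cart)
    also have "\<dots> \<le> (\<Sum>i\<in>UNIV. \<Sum>j\<in>UNIV. ?S $ i $ i + ?T $ j $ j)"
      by (intro sum_mono entry)
    finally show ?thesis .
  qed
  then have "bounded (range C)" by (auto simp: bounded_iff)
  from bounded_imp_convergent_subsequence[OF this] obtain C' r
    where r: "strict_mono r" and lim: "(C \<circ> r) \<longlonglongrightarrow> C'" by auto
  have lim_entry: "(\<lambda>k. C (r k) $ i $ j) \<longlonglongrightarrow> C' $ i $ j" for i j
    using lim by (intro tendsto_vec_nth) (simp add: comp_def)
  \<comment> \<open>Written in entries, the quadratic form and the cost are finite expressions
    continuous in \<open>C\<close>, so positivity and the cost bound survive in the limit.\<close>
  have "(\<lambda>k. s \<bullet> (?S *v s) + 2 * (s \<bullet> (C (r k) *v t)) + t \<bullet> (?T *v t))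
      \<longlonglongrightarrow> s \<bullet> (?S *v s) + 2 * (s \<bullet> (C' *v t)) + t \<bullet> (?T *v t)" for s t
    unfolding inner_vec_def matrix_vector_mult_def inner_real_def vec_lambda_beta
    by (intro tendsto_intros lim_entry)
  then have psd': "0 \<le> s \<bullet> (?S *v s) + 2 * (s \<bullet> (C' *v t)) + t \<bullet> (?T *v t)" for s t
    using psd by (blast intro: LIMSEQ_le_const)
  have "(\<lambda>k. sqrt (cost (C (r k)))) \<longlonglongrightarrow> sqrt (cost C')"
    unfolding cost_def trace_def by (intro tendsto_intros lim_entry)
  moreover have "(\<lambda>k. ?w + 1 / real (Suc (r k))) \<longlonglongrightarrow> ?w + 0"
    using LIMSEQ_subseq_LIMSEQ[OF LIMSEQ_Suc[OF lim_1_over_n] r] by (intro tendsto_intros) (simp add: comp_def)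
  ultimately have cost': "sqrt (cost C') \<le> ?w"
    using cost by (auto intro: LIMSEQ_le)
  have "transpose ?S = ?S" "transpose ?T = ?T"
    by (simp_all add: transpose_def cov_mat_def mult.commute)
  from gaussian_coupling_exists[OF this psd', of "mean_vec P" "mean_vec Q"]
  obtain P' Q' \<gamma> where n: "is_normal_law (mean_vec P) ?S P'" "is_normal_law (mean_vec Q) ?T Q'"
    and \<gamma>: "\<gamma> \<in> couplings P' Q'" "(\<integral>(x, y). (norm (x - y))\<^sup>2 \<partial>\<gamma>) = cost C'"
    unfolding cost_def by metis
  have "wasserstein2 P' Q' \<le> ?w"
    using wasserstein2_le[OF \<gamma>(1)] cost' by (simp add: \<gamma>(2))
  from that[OF n this] show thesis .
qed

theorem lemma1:
  fixes \<nu> :: "real ^ 'd ^ 'd \<Rightarrow> real" and n N :: nat and \<epsilon> \<delta> :: real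
  assumes "n \<ge> 1" and "N \<ge> 1" and "\<epsilon> > 0" and "\<delta> > 0"
    and "\<nu> \<in> {frobenius_norm, trace, operator_norm}"
  shows "(\<forall>A B. (SUP PQ \<in> feasible \<nu> \<epsilon> \<delta>. normalized_risk \<nu> n N A B PQ)
              = (SUP PQ \<in> feasible \<nu> \<epsilon> \<delta> \<inter> gaussian_pairs. normalized_risk \<nu> n N A B PQ))
       \<and> (INF A. INF B. SUP PQ \<in> feasible \<nu> \<epsilon> \<delta>. normalized_risk \<nu> n N A B PQ)
         = (INF A. INF B. SUP PQ \<in> feasible \<nu> \<epsilon> \<delta> \<inter> gaussian_pairs. normalized_risk \<nu> n N A B PQ)"
proof -
  have "(SUP PQ \<in> feasible \<nu> \<epsilon> \<delta>. normalized_risk \<nu> n N A B PQ)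
      = (SUP PQ \<in> feasible \<nu> \<epsilon> \<delta> \<inter> gaussian_pairs. normalized_risk \<nu> n N A B PQ)" for A B
  proof (rule antisym)
    show "(SUP PQ \<in> feasible \<nu> \<epsilon> \<delta>. normalized_risk \<nu> n N A B PQ)
        \<le> (SUP PQ \<in> feasible \<nu> \<epsilon> \<delta> \<inter> gaussian_pairs. normalized_risk \<nu> n N A B PQ)"
    proof (rule SUP_mono)
      fix PQ assume PQ: "PQ \<in> feasible \<nu> \<epsilon> \<delta>"
      obtain P Q where [simp]: "PQ = (P, Q)" by (cases PQ)
      have P: "P \<in> prob2" and Q: "Q \<in> prob2" and W: "wasserstein2 P Q \<le> \<epsilon>" and \<delta>: "\<nu> (cov_mat P) \<ge> \<delta>\<^sup>2"
        using PQ by (auto simp: feasible_def)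
      obtain P' Q' where n: "is_normal_law (mean_vec P) (cov_mat P) P'" "is_normal_law (mean_vec Q) (cov_mat Q) Q'"
        and W': "wasserstein2 P' Q' \<le> wasserstein2 P Q"
        using gaussian_pair_exists[OF P Q] .
      note n2 = n[THEN is_normal_law_prob2]
      note mom = n[THEN is_normal_law_mean] n[THEN is_normal_law_cov]
      have "(P', Q') \<in> feasible \<nu> \<epsilon> \<delta> \<inter> gaussian_pairs"
        using n n2 W W' \<delta> by (simp add: feasible_def gaussian_pairs_def mom)
      moreover have "mean_sq_error n N A B P Q = mean_sq_error n N A B P' Q'"
        using assms P Q n2 by (simp add: mean_sq_error_eq mom)
      \<comment> \<open>The denominators agree as well, because the covariance of the first
        component is preserved.\<close>
      then have "normalized_risk \<nu> n N A B PQ = normalized_risk \<nu> n N A B (P', Q')"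
        by (simp add: normalized_risk_def mom)
      ultimately show "\<exists>PQ'\<in>feasible \<nu> \<epsilon> \<delta> \<inter> gaussian_pairs.
          normalized_risk \<nu> n N A B PQ \<le> normalized_risk \<nu> n N A B PQ'" by force
    qed
  qed (intro SUP_subset_mono, auto)
  then show ?thesis by simp
qed

end
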